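(* Let $k \geq 2$ be an integer, and let $\alpha^{**}$ be the unique root in $(1/2,1)$ of the equation $$\alpha = \frac{1}{2} + \sum^{\infty}_{i=k} \frac{1}{i!}\left(\ln \frac{1}{2-2\alpha}\right)^i.$$ Then $\tilde{c}_k \leq \alpha^{**}$.
   Context: A subset $A$ of an additive group is called sumfree if $x+y\neq z$ for all $x,y,z\in A$ (not necessarily distinct). For a positive integer $k$, subsets of $[0,1]^k$ are regarded as subsets of the additive group $\mathbb{R}^k$, $\mathrm{Vol}$ denotes Lebesgue measure on $\mathbb{R}^k$, and $$\tilde{c}_k := \sup \{\mathrm{Vol}(S) : S \subset [0,1]^k \text{ is Lebesgue measurable and sumfree}\}.$$ *)

theory Defs
  imports "HOL-Analysis.Analysis"
begin

definition sumfree :: "'a::group_add set \<Rightarrow> bool" where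
  "sumfree A \<longleftrightarrow> (\<forall>x\<in>A. \<forall>y\<in>A. \<forall>z\<in>A. x + y \<noteq> z)"

text \<open>The ambient space is \<open>real ^ 'n\<close>, so the dimension \<open>k\<close> is \<open>CARD('n)\<close>;
  \<open>cbox 0 1\<close> is the cube with vertices \<open>(0, ..., 0)\<close> and \<open>(1, ..., 1)\<close>.
  The supremum is over a nonempty set of reals (take \<open>S = {}\<close>) bounded above by 1.\<close>

definition c_tilde :: "'n::finite itself \<Rightarrow> real" where
  "c_tilde _ = Sup {measure lebesgue S | S :: (real ^ 'n) set.
      S \<subseteq> cbox 0 1 \<and> S \<in> sets lebesgue \<and> sumfree S}"

lemma mem_unit_cube: "x \<in> cbox (0 :: real ^ 'n) 1 \<longleftrightarrow> (\<forall>i. 0 \<le> x $ i \<and> x $ i \<le> 1)"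
  by (simp add: mem_box_cart)

definition is_alpha_root :: "nat \<Rightarrow> real \<Rightarrow> bool" where
  "is_alpha_root k \<alpha> \<longleftrightarrow> \<alpha> \<in> {1/2<..<1} \<and>
     \<alpha> = 1/2 + (\<Sum>\<^sub>\<infinity>i\<in>{k..}. 1 / fact i * ln (1 / (2 - 2 * \<alpha>)) ^ i)"

end

theory Submission
  imports Defs
begin

text \<open>
  Write \<open>\<pi> x\<close> for the product of the coordinates of \<open>x\<close>, and let \<open>S\<close> be a sumfree subset of the
  cube. For \<open>z \<in> S\<close> the reflection \<open>x \<mapsto> z - x\<close> maps \<open>S \<inter> [0, z]\<close> into \<open>[0, z] - S\<close>, so \<open>S\<close> misses
  at least half of the box \<open>[0, z]\<close>, a volume of \<open>\<pi> z / 2\<close>. If \<open>z\<close> nearly maximises \<open>\<pi>\<close> on \<open>S\<close>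
  and \<open>t\<close> is slightly larger than \<open>\<pi> z\<close>, then \<open>S\<close> also misses the disjoint region \<open>\<pi> \<ge> t\<close>, whose
  volume is \<open>t * T\<^sub>k (ln (1 / t))\<close> for the tail \<open>T\<^sub>k\<close> of the exponential series.
  Put \<open>\<beta> = 2 - 2 * \<alpha>\<close> and \<open>L = ln (1 / \<beta>)\<close>; the equation for \<open>\<alpha>\<close> becomes
  \<open>T\<^sub>k L = (1 - exp (- L)) / 2\<close>, which forces \<open>L ^ (k - 1) / (k - 1)! \<ge> 1 / 2\<close>, and therefore
  \<open>t * (T\<^sub>k (ln (1 / t)) + 1 / 2)\<close> is decreasing in \<open>t\<close> on \<open>(0, \<beta>]\<close>. If the volume of \<open>S\<close>
  exceeded \<open>\<alpha>\<close>, the missing volume would be less than \<open>\<beta> / 2\<close>; this gives \<open>\<pi> < \<beta>\<close> on \<open>S\<close>, so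
  monotonicity applies and shows that the missing volume is at least \<open>\<beta> / 2\<close>, a contradiction.
\<close>


section \<open>Tails of the exponential series\<close>

text \<open>Taken as \<open>exp\<close> minus a finite sum, so that calculus needs no infinite
  series; \<open>infsum_exp_tail\<close> matches it with the sum in the equation for
  \<alpha>.\<close>

definition exp_tail :: "nat \<Rightarrow> real \<Rightarrow> real" where
  "exp_tail n x = exp x - (\<Sum>i<n. x ^ i / fact i)"

lemma exp_tail_0 [simp]: "exp_tail 0 x = exp x"
  by (simp add: exp_tail_def)

lemma exp_tail_Suc: "exp_tail (Suc n) x = exp_tail n x - x ^ n / fact n"
  by (simp add: exp_tail_def)

lemma exp_tail_at_0 [simp]: "exp_tail (Suc n) 0 = 0"
  by (induction n) (simp_all add: exp_tail_Suc)

lemma has_real_derivative_exp_tail: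
  "(exp_tail (Suc n) has_real_derivative exp_tail n x) (at x within A)"
proof (induction n arbitrary: x)
  case 0
  show ?case
    unfolding exp_tail_def by (auto intro!: derivative_eq_intros)
next
  case (Suc n)
  have "((\<lambda>y. y ^ Suc n / fact (Suc n)) has_real_derivative x ^ n / fact n) (at x within A)"
    using DERIV_cdivide[OF DERIV_pow[of "Suc n" x A], of "fact (Suc n)"]
    by (simp add: divide_simps del: power_Suc of_nat_Suc)
  from DERIV_diff[OF Suc.IH this]
  have "((\<lambda>y. exp_tail (Suc n) y - y ^ Suc n / fact (Suc n)) has_real_derivative
          exp_tail n x - x ^ n / fact n) (at x within A)" .
  moreover have "exp_tail (Suc (Suc n)) = (\<lambda>y. exp_tail (Suc n) y - y ^ Suc n / fact (Suc n))"
    by (rule ext) (rule exp_tail_Suc)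
  ultimately show ?case
    by (simp only: exp_tail_Suc[of n])
qed

lemma continuous_on_exp_tail [continuous_intros]:
  "continuous_on A f \<Longrightarrow> continuous_on A (\<lambda>x. exp_tail n (f x))"
  unfolding exp_tail_def by (intro continuous_intros) auto

text \<open>Induction on the index: the derivative of a tail is the previous tail, and a tail of
  positive index vanishes at 0.\<close>

lemma exp_tail_pos: "0 < x \<Longrightarrow> 0 < exp_tail n x"
proof (induction n arbitrary: x)
  case (Suc n)
  have "exp_tail (Suc n) 0 < exp_tail (Suc n) x"
  proof (rule DERIV_pos_imp_increasing_open[OF Suc.prems])
    show "\<exists>d. (exp_tail (Suc n) has_real_derivative d) (at y) \<and> 0 < d" if "0 < y" for y
      using has_real_derivative_exp_tail[of n] Suc.IH[OF that] by blast
    show "continuous_on {0..x} (exp_tail (Suc n))"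
      by (rule continuous_on_exp_tail[OF continuous_on_id, unfolded id_def])
  qed
  then show ?case by simp
qed simp

lemma exp_tail_nonneg: "0 \<le> x \<Longrightarrow> 0 \<le> exp_tail n x"
  by (cases "x = 0"; cases n) (auto intro: less_imp_le[OF exp_tail_pos])

lemma exp_tail_strict_mono:
  assumes "0 \<le> x" "x < y"
  shows "exp_tail n x < exp_tail n y"
proof (cases n)
  case (Suc m)
  show ?thesis
    unfolding Suc
  proof (rule DERIV_pos_imp_increasing_open[OF assms(2)])
    show "\<exists>d. (exp_tail (Suc m) has_real_derivative d) (at u) \<and> 0 < d" if "x < u" for u
      using has_real_derivative_exp_tail[of m] exp_tail_pos[of u m] that assms by fastforce
    show "continuous_on {x..y} (exp_tail (Suc m))"
      by (rule continuous_on_exp_tail[OF continuous_on_id, unfolded id_def])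
  qed
qed (use assms in simp)

lemma exp_tail_ge: "0 \<le> x \<Longrightarrow> x ^ n / fact n \<le> exp_tail n x"
  using exp_tail_nonneg[of x "Suc n"] by (simp add: exp_tail_Suc)

text \<open>Termwise: \<open>(n + 1) * x ^ j / j! \<le> x * x ^ (j - 1) / (j - 1)!\<close> for \<open>j > n\<close>.\<close>

lemma exp_tail_Suc_le:
  assumes "0 \<le> x"
  shows "real (Suc n) * exp_tail (Suc n) x \<le> x * exp_tail n x"
  using assms
proof (induction n arbitrary: x)
  case 0
  have "0 * exp_tail 0 0 - exp_tail (Suc 0) 0 \<le> x * exp_tail 0 x - exp_tail (Suc 0) x"
  proof (rule DERIV_nonneg_imp_nondecreasing[OF 0])
    fix y :: real assume "0 \<le> y"
    moreover have "((\<lambda>y. y * exp_tail 0 y - exp_tail (Suc 0) y) has_real_derivative y * exp y) (at y)"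
      unfolding exp_tail_0
      by (auto intro!: derivative_eq_intros has_real_derivative_exp_tail)
    ultimately show "\<exists>d. ((\<lambda>y. y * exp_tail 0 y - exp_tail (Suc 0) y) has_real_derivative d) (at y)
        \<and> 0 \<le> d"
      by (meson exp_ge_zero mult_nonneg_nonneg)
  qed
  then show ?case by simp
next
  case (Suc n)
  \<comment> \<open>\<open>?D\<close> vanishes at 0, and its derivative is the same difference one
    index lower, nonnegative by the induction hypothesis.\<close>
  let ?D = "\<lambda>y. y * exp_tail (Suc n) y - real (Suc (Suc n)) * exp_tail (Suc (Suc n)) y"
  have "?D 0 \<le> ?D x"
  proof (rule DERIV_nonneg_imp_nondecreasing[OF Suc.prems])
    fix y :: real assume "0 \<le> y"
    moreover have "(?D has_real_derivative y * exp_tail n y - real (Suc n) * exp_tail (Suc n) y) (at y)"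
      by (auto intro!: derivative_eq_intros has_real_derivative_exp_tail simp: algebra_simps)
    ultimately show "\<exists>d. (?D has_real_derivative d) (at y) \<and> 0 \<le> d"
      using Suc.IH[of y] by (meson diff_ge_0_iff_ge)
  qed
  then show ?case by simp
qed

lemma infsum_exp_tail:
  fixes x :: real
  shows "(\<Sum>\<^sub>\<infinity>i\<in>{n..}. 1 / fact i * x ^ i) = exp_tail n x"
proof -
  let ?f = "\<lambda>i. 1 / fact i * x ^ i :: real"
  have "summable (\<lambda>i. norm (?f i))"
    using summable_norm_exp[of x] by (simp add: divide_inverse)
  moreover have "?f sums exp x"
    using exp_converges[of x] by (simp add: divide_inverse)
  ultimately have "(?f has_sum exp x) UNIV"
    by (rule norm_summable_imp_has_sum)
  moreover have "(?f has_sum sum ?f {..<n}) {..<n}"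
    by (rule has_sum_finite) simp
  ultimately have "(?f has_sum (exp x - sum ?f {..<n})) (UNIV - {..<n})"
    by (rule has_sum_Diff) simp
  moreover have "UNIV - {..<n} = {n..}"
    by auto
  ultimately show ?thesis
    using infsumI by (fastforce simp: exp_tail_def)
qed

section \<open>The equation for \<alpha> in a logarithmic variable\<close>

text \<open>From \<open>exp (-L) = 2 - 2 * \<alpha>\<close> follows
  \<open>\<alpha> - 1/2 = (1 - exp (-L)) / 2\<close>, so the equation involves \<open>L\<close>
  alone.\<close>

lemma root_in_log_coordinate:
  fixes \<alpha> :: real
  assumes "1 / 2 < \<alpha>" "\<alpha> < 1"
  defines "L \<equiv> ln (1 / (2 - 2 * \<alpha>))"
  shows "0 < L" "exp (-L) = 2 - 2 * \<alpha>"
    "is_alpha_root k \<alpha> \<longleftrightarrow> exp_tail k L = (1 - exp (-L)) / 2"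
proof -
  show "0 < L"
    unfolding L_def using assms(1,2) by (intro ln_gt_zero) (simp add: field_simps)
  show *: "exp (-L) = 2 - 2 * \<alpha>"
    using assms(1,2) by (simp add: L_def exp_minus)
  show "is_alpha_root k \<alpha> \<longleftrightarrow> exp_tail k L = (1 - exp (-L)) / 2"
    unfolding * is_alpha_root_def infsum_exp_tail L_def[symmetric] using assms(1,2) by auto
qed

text \<open>The difference \<open>g\<close> of the two sides is 0 at 0, positive just to the right
  of 0 and negative at \<open>b\<close>, which gives a positive zero. Its derivative is strictly
  decreasing on \<open>x \<ge> 0\<close>, which rules out a second one.\<close>

lemma ex1_root_log:
  assumes "k \<ge> 2"
  shows "\<exists>!x. 0 < x \<and> exp_tail k x = (1 - exp (-x)) / 2"
proof -
  obtain m where k: "k = Suc (Suc m)"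
    using assms by (metis Suc_le_D numeral_2_eq_2 Suc_le_mono)
  define g where "g x = (1 - exp (-x)) / 2 - exp_tail k x" for x
  define g' where "g' x = exp (-x) / 2 - exp_tail (Suc m) x" for x
  have g0: "g 0 = 0"
    by (simp add: g_def k)
  have deriv: "(g has_real_derivative g' x) (at x)" for x
    unfolding g_def g'_def k
    by (auto intro!: derivative_eq_intros has_real_derivative_exp_tail)
  have cont: "continuous_on A g" for A
    unfolding g_def by (intro continuous_intros) auto
  have g'_less: "g' y < g' x" if "0 \<le> x" "x < y" for x y
    unfolding g'_def using exp_tail_strict_mono[OF that, of "Suc m"] that(2) by (intro diff_strict_mono) auto
  \<comment> \<open>\<open>k \<ge> 2\<close> makes the index \<open>Suc m\<close> positive, so the
    tail in \<open>g'\<close> vanishes at 0 and 1/2 remains.\<close>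
  have "0 < g' 0"
    by (simp add: g'_def)
  then obtain d where d: "0 < d" "\<And>h. 0 < h \<Longrightarrow> h < d \<Longrightarrow> g 0 < g (0 + h)"
    using DERIV_pos_inc_right[OF deriv[of 0]] by blast
  define a where "a = min (d / 2) (1 / 2)"
  \<comment> \<open>At \<open>fact k\<close> the first term of the tail is already at least 1, while
    \<open>(1 - exp (-x)) / 2\<close> stays below 1/2.\<close>
  define b :: real where "b = fact k"
  have a: "0 < a" "a < 1" "0 < g a"
    using d(2)[of a] d(1) g0 by (auto simp: a_def min_def)
  have b: "1 \<le> b"
    unfolding b_def by (rule fact_ge_1)
  have "1 \<le> b ^ k / fact k"
    using b power_increasing[of 1 k b] assms by (simp add: b_def)
  also have "\<dots> \<le> exp_tail k b"
    using b by (intro exp_tail_ge) auto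
  finally have "g b < 0"
    unfolding g_def using exp_gt_zero[of "-b"] by (simp add: field_simps add_strict_increasing)
  then have "\<exists>x. a \<le> x \<and> x \<le> b \<and> g x = 0"
    using IVT2'[of g b 0 a] a b cont by auto
  then have ex: "\<exists>x. 0 < x \<and> g x = 0"
    using a(1) by (meson less_le_trans)
  \<comment> \<open>A second positive root would, by Rolle, give two zeros of the strictly decreasing \<open>g'\<close>.\<close>
  have False if "0 < x" "g x = 0" "x < y" "g y = 0" for x y
  proof -
    have "\<exists>u>0. u < x \<and> (\<lambda>v. g' u * v) = (\<lambda>v. 0)"
      using that g0 deriv
      by (intro Rolle_deriv[of 0 x g "\<lambda>u v. g' u * v"] cont)
         (auto simp: has_field_derivative_def)
    moreover have "\<exists>w>x. w < y \<and> (\<lambda>v. g' w * v) = (\<lambda>v. 0)"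
      using that deriv
      by (intro Rolle_deriv[of x y g "\<lambda>u v. g' u * v"] cont)
         (auto simp: has_field_derivative_def)
    ultimately obtain u w where u: "0 < u" "u < x" "(\<lambda>v. g' u * v) = (\<lambda>v. 0)"
      and w: "x < w" "w < y" "(\<lambda>v. g' w * v) = (\<lambda>v. 0)"
      by blast
    then have "g' u = 0" "g' w = 0"
      by (metis mult.right_neutral)+
    with g'_less[of u w] u w show False
      by simp
  qed
  with ex have "\<exists>!x. 0 < x \<and> g x = 0"
    by (metis linorder_neqE_linordered_idom)
  then show ?thesis
    unfolding g_def by (metis eq_iff_diff_eq_0)
qed

text \<open>\<open>1 - exp (-x) / 2\<close> inverts the substitution, so existence and uniqueness
  carry over from \<open>ex1_root_log\<close>.\<close>

lemma ex1_alpha_root: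
  assumes "k \<ge> 2"
  shows "\<exists>!\<alpha>. is_alpha_root k \<alpha>"
proof -
  define L where "L = (\<lambda>\<alpha>::real. ln (1 / (2 - 2 * \<alpha>)))"
  have range: "1 / 2 < \<alpha> \<and> \<alpha> < 1" if "is_alpha_root k \<alpha>" for \<alpha>
    using that by (simp add: is_alpha_root_def)
  obtain x where x: "0 < x" "exp_tail k x = (1 - exp (-x)) / 2"
    and uniq: "\<And>y. 0 < y \<and> exp_tail k y = (1 - exp (-y)) / 2 \<Longrightarrow> y = x"
    using ex1_root_log[OF assms] by blast
  define \<alpha> where "\<alpha> = 1 - exp (-x) / 2"
  have \<alpha>: "1 / 2 < \<alpha>" "\<alpha> < 1"
    using x(1) by (auto simp: \<alpha>_def)
  have "2 - 2 * \<alpha> = exp (-x)"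
    by (simp add: \<alpha>_def)
  then have "L \<alpha> = x"
    using \<alpha> by (simp add: L_def ln_div)
  then have "is_alpha_root k \<alpha>"
    using root_in_log_coordinate(3)[OF \<alpha>] x(2) by (simp add: L_def)
  moreover have "\<beta> = \<alpha>" if "is_alpha_root k \<beta>" for \<beta>
  proof -
    note \<beta> = range[OF that]
    have "L \<beta> = x"
      using root_in_log_coordinate(1,3)[of \<beta>] \<beta> that by (intro uniq) (auto simp: L_def)
    then show ?thesis
      using root_in_log_coordinate(2)[of \<beta>] \<beta> by (simp add: \<alpha>_def L_def field_simps)
  qed
  ultimately show ?thesis
    by blast
qed

section \<open>Monotonicity from the root on\<close>

text \<open>By Bernoulli's inequality \<open>(1 + 1/n) ^ n \<ge> 2\<close>, so passing from
  \<open>n\<close> to \<open>n + 1\<close> multiplies the right side by at least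
  \<open>n + 1\<close>.\<close>

lemma fact_le_half_power: "1 \<le> n \<Longrightarrow> fact n / 2 \<le> (real n / 2) ^ n"
proof (induction n rule: dec_induct)
  case (step n)
  have "2 \<le> (1 + 1 / real n) ^ n"
    using Bernoulli_inequality[of "1 / real n" n] step.hyps by (simp add: divide_simps split: if_splits)
  moreover have "real (Suc n) / 2 = (1 + 1 / real n) * (real n / 2)"
    using step.hyps by (simp add: field_simps)
  then have "(real (Suc n) / 2) ^ n = (1 + 1 / real n) ^ n * (real n / 2) ^ n"
    by (simp only: power_mult_distrib)
  ultimately have "2 * (fact n / 2) \<le> (real (Suc n) / 2) ^ n"
    using mult_mono[OF _ step.IH, of 2 "(1 + 1 / real n) ^ n"] by simp
  then have "real (Suc n) / 2 * (2 * (fact n / 2)) \<le> real (Suc n) / 2 * (real (Suc n) / 2) ^ n"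
    by (intro mult_left_mono) auto
  then show ?case
    by simp
qed simp

text \<open>If \<open>L ^ n / fact n < 1/2\<close>, then \<open>L < n/2\<close>, so
  \<open>n + 1 - L\<close> exceeds \<open>1 + L\<close>, and \<open>exp_tail_Suc_le\<close> makes
  the tail less than \<open>L / (2 * (1 + L))\<close>. The root equation then gives
  \<open>1 < (1 + L) * exp (-L)\<close>, against \<open>1 + L \<le> exp L\<close>.\<close>

lemma root_power_ge:
  assumes "1 \<le> n" "0 < L" and root: "exp_tail (Suc n) L = (1 - exp (-L)) / 2"
  shows "1 / 2 \<le> L ^ n / fact n"
proof (rule ccontr)
  let ?T = "exp_tail (Suc n) L"
  assume "\<not> ?thesis"
  then have small: "L ^ n / fact n < 1 / 2"
    by simp
  then have "L ^ n < fact n / 2"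
    by (simp add: field_simps)
  also have "\<dots> \<le> (real n / 2) ^ n"
    by (rule fact_le_half_power[OF assms(1)])
  finally have "L < real n / 2"
    by (rule power_less_imp_less_base) simp
  then have "(1 + L) * ?T \<le> (real (Suc n) - L) * ?T"
    using assms(2) by (intro mult_right_mono exp_tail_nonneg) auto
  also have "\<dots> \<le> L * (L ^ n / fact n)"
  proof -
    have "exp_tail n L = ?T + L ^ n / fact n"
      by (simp add: exp_tail_Suc)
    with exp_tail_Suc_le[of L n] assms(2)
    have "real (Suc n) * ?T \<le> L * (?T + L ^ n / fact n)"
      by simp
    then show ?thesis
      unfolding left_diff_distrib distrib_left by linarith
  qed
  also have "\<dots> < L * (1 / 2)"
    using small assms(2) by (intro mult_strict_left_mono) auto
  finally have "(1 + L) * (1 - exp (-L)) < L"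
    unfolding root by simp
  moreover have "(1 + L) * exp (-L) \<le> exp L * exp (-L)"
    by (intro mult_right_mono exp_ge_add_one_self) auto
  ultimately show False
    by (simp add: algebra_simps flip: exp_add)
qed

text \<open>The derivative at \<open>x\<close> is \<open>exp (-x) * (x ^ n / fact n - 1/2)\<close>,
  nonnegative from \<open>L\<close> on. Substituting \<open>t = exp (-x)\<close> turns this into the
  monotonicity in \<open>t\<close>.\<close>

lemma exp_tail_weighted_mono:
  assumes "0 \<le> L" "L \<le> M" "1 / 2 \<le> L ^ n / fact n"
  shows "exp (-L) * (exp_tail (Suc n) L + 1 / 2) \<le> exp (-M) * (exp_tail (Suc n) M + 1 / 2)"
proof (rule DERIV_nonneg_imp_nondecreasing[OF assms(2)])
  fix x assume "L \<le> x" "x \<le> M"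
  then have "L ^ n / fact n \<le> x ^ n / fact n"
    using assms(1) by (intro divide_right_mono power_mono) auto
  then have "0 \<le> exp (-x) * (x ^ n / fact n - 1 / 2)"
    using order_trans[OF assms(3)] by (metis diff_ge_0_iff_ge exp_ge_zero mult_nonneg_nonneg)
  moreover have "((\<lambda>x. exp (-x) * (exp_tail (Suc n) x + 1 / 2)) has_real_derivative
      exp (-x) * exp_tail n x - exp (-x) * (exp_tail (Suc n) x + 1 / 2)) (at x)"
    by (auto intro!: derivative_eq_intros has_real_derivative_exp_tail)
  moreover have "exp (-x) * exp_tail n x - exp (-x) * (exp_tail (Suc n) x + 1 / 2)
      = exp (-x) * (x ^ n / fact n - 1 / 2)"
    by (simp add: exp_tail_Suc algebra_simps)
  ultimately show "\<exists>d. ((\<lambda>x. exp (-x) * (exp_tail (Suc n) x + 1 / 2)) has_real_derivative d) (at x)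
      \<and> 0 \<le> d"
    by metis
qed


section \<open>Volume of the region where the product of coordinates is large\<close>

text \<open>Induction by slicing along a new coordinate \<open>y\<close>: the slice is the region
  for \<open>t / y\<close> if \<open>t \<le> y \<le> 1\<close>, and empty otherwise. Arbitrary
  finite index sets let the dimension vary.\<close>

lemma emeasure_PiM_prod_ge:
  fixes t :: real
  assumes "finite I" "0 < t" "t \<le> 1"
  shows "emeasure (\<Pi>\<^sub>M i\<in>I. lborel)
      {f \<in> space (\<Pi>\<^sub>M i\<in>I. lborel). (\<forall>i\<in>I. f i \<in> {0..1}) \<and> t \<le> (\<Prod>i\<in>I. f i)}
    = ennreal (t * exp_tail (card I) (- ln t))"
  using assms
proof (induction I arbitrary: t rule: finite_induct)
  case empty
  then show ?case
    by (simp add: space_PiM exp_minus)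
next
  case (insert i I)
  interpret product_sigma_finite "\<lambda>_. lborel :: real measure" ..
  note [measurable] = \<open>finite I\<close>
  define P where "P J = (\<Pi>\<^sub>M j\<in>J. (lborel :: real measure))" for J :: "'a set"
  define A where "A J s = {f \<in> space (P J). (\<forall>j\<in>J. f j \<in> {0..1}) \<and> s \<le> (\<Prod>j\<in>J. f j)}"
    for J and s :: real
  have A_sets: "A J s \<in> sets (P J)" if "finite J" for J s
    using that unfolding A_def P_def by measurable
  have slice: "(\<integral>\<^sup>+ x. indicator (A (insert i I) t) (x(i := y)) \<partial>P I)
      = ennreal (t / y * exp_tail (card I) (ln y - ln t)) * indicator {t..1} y" for y
  proof (cases "y \<in> {t..1}")
    case True
    then have y: "0 < y" "0 < t / y" "t / y \<le> 1"
      using insert.prems by auto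
    have "(\<integral>\<^sup>+ x. indicator (A (insert i I) t) (x(i := y)) \<partial>P I)
        = (\<integral>\<^sup>+ x. indicator (A I (t / y)) x \<partial>P I)"
    proof (rule nn_integral_cong)
      fix x assume "x \<in> space (P I)"
      then have "x(i := y) \<in> space (P (insert i I))"
        by (auto simp: P_def space_PiM PiE_iff extensional_def)
      moreover have "(\<Prod>j\<in>insert i I. (x(i := y)) j) = y * (\<Prod>j\<in>I. x j)"
        using insert.hyps by (auto intro: prod.cong)
      moreover have "(\<forall>j\<in>insert i I. (x(i := y)) j \<in> {0..1}) \<longleftrightarrow> (\<forall>j\<in>I. x j \<in> {0..1})"
        using insert.hyps True y by auto
      ultimately have "x(i := y) \<in> A (insert i I) t \<longleftrightarrow> x \<in> A I (t / y)"
        unfolding A_def using \<open>x \<in> space (P I)\<close> y(1)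
        by (simp add: pos_divide_le_eq mult.commute del: prod.insert fun_upd_apply ball_simps)
      then show "indicator (A (insert i I) t) (x(i := y)) = (indicator (A I (t / y)) x :: ennreal)"
        by (simp add: indicator_def)
    qed
    also have "\<dots> = emeasure (P I) (A I (t / y))"
      by (intro nn_integral_indicator A_sets insert.hyps)
    also have "\<dots> = ennreal (t / y * exp_tail (card I) (- ln (t / y)))"
      unfolding A_def P_def by (rule insert.IH[OF y(2,3)])
    finally show ?thesis
      using True y insert.prems by (simp add: ln_div)
  next
    case False
    have "x(i := y) \<notin> A (insert i I) t" for x
    proof
      assume "x(i := y) \<in> A (insert i I) t"
      then have 1: "0 \<le> y" "y \<le> 1" "\<And>j. j \<in> I \<Longrightarrow> 0 \<le> x j \<and> x j \<le> 1" "t \<le> (\<Prod>j\<in>insert i I. (x(i := y)) j)"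
        using insert.hyps by (auto simp: A_def split: if_splits)
      have "(\<Prod>j\<in>insert i I. (x(i := y)) j) = y * (\<Prod>j\<in>I. (x(i := y)) j)"
        using insert.hyps by simp
      also have "(\<Prod>j\<in>I. (x(i := y)) j) = (\<Prod>j\<in>I. x j)"
        using insert.hyps by (intro prod.cong) auto
      also have "y * (\<Prod>j\<in>I. x j) \<le> y * 1"
        using 1 by (intro mult_left_mono prod_le_1) auto
      finally show False
        using 1 False by simp
    qed
    then show ?thesis
      using False by simp
  qed
  have "emeasure (P (insert i I)) (A (insert i I) t)
      = (\<integral>\<^sup>+ f. indicator (A (insert i I) t) f \<partial>P (insert i I))"
    using insert.hyps A_sets by (intro nn_integral_indicator[symmetric]) simp
  also have "\<dots> = (\<integral>\<^sup>+ y. (\<integral>\<^sup>+ x. indicator (A (insert i I) t) (x(i := y)) \<partial>P I) \<partial>lborel)"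
    unfolding P_def using insert.hyps A_sets[of "insert i I" t]
    by (intro product_nn_integral_insert_rev borel_measurable_indicator) (auto simp: P_def)
  also have "\<dots> = (\<integral>\<^sup>+ y. ennreal (t / y * exp_tail (card I) (ln y - ln t)) * indicator {t..1} y \<partial>lborel)"
    by (simp only: slice)
  \<comment> \<open>The antiderivative in \<open>y\<close> is \<open>t\<close> times the next tail
    at \<open>ln y - ln t\<close>, which vanishes at \<open>y = t\<close>.\<close>
  also have "\<dots> = ennreal (t * exp_tail (Suc (card I)) (ln 1 - ln t)
                          - t * exp_tail (Suc (card I)) (ln t - ln t))"
  proof (rule nn_integral_FTC_Icc)
    show "(\<lambda>y. t / y * exp_tail (card I) (ln y - ln t)) \<in> borel_measurable borel"
      unfolding exp_tail_def by measurable
    fix y assume y: "y \<in> {t..1}"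
    then have "0 < y" using insert.prems by simp
    show "0 \<le> t / y * exp_tail (card I) (ln y - ln t)"
      using y insert.prems by (intro mult_nonneg_nonneg exp_tail_nonneg) auto
    have "((\<lambda>y. exp_tail (Suc (card I)) (ln y - ln t)) has_real_derivative
             exp_tail (card I) (ln y - ln t) * (1 / y)) (at y)"
      using \<open>0 < y\<close> insert.prems
      by (intro DERIV_chain2[OF has_real_derivative_exp_tail]) (auto intro!: derivative_eq_intros)
    from DERIV_cmult[OF this, of t]
    show "((\<lambda>y. t * exp_tail (Suc (card I)) (ln y - ln t)) has_real_derivative
             t / y * exp_tail (card I) (ln y - ln t)) (at y)"
      by (simp add: mult_ac)
  qed (use insert.prems in auto)
  finally show ?case
    using insert.hyps by (simp add: A_def P_def)
qed

lemma prod_Basis_cart: "(\<Prod>b\<in>Basis. x \<bullet> b) = (\<Prod>i\<in>UNIV. x $ i)" for x :: "real ^ 'n::finite"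
  by (simp add: Basis_vec_def cart_eq_inner_axis axis_eq_axis prod.UNION_disjoint)

text \<open>\<open>lborel\<close> is the image of the product measure over \<open>Basis\<close>,
  which carries the computation over to \<open>real ^ 'n\<close>.\<close>

lemma hyperbolic_region:
  fixes t :: real
  assumes "0 < t" "t \<le> 1"
  defines "H \<equiv> {x \<in> cbox (0 :: real ^ 'n::finite) 1. t \<le> (\<Prod>i\<in>UNIV. x $ i)}"
  shows "H \<in> lmeasurable" "measure lebesgue H = t * exp_tail CARD('n) (- ln t)"
proof -
  have meas: "H \<in> sets borel"
    unfolding H_def mem_unit_cube by measurable
  define B where "B = (Basis :: (real ^ 'n) set)"
  have inner: "(\<Sum>c\<in>B. f c *\<^sub>R c) \<bullet> b = f b" if "b \<in> B" for f b
    using that unfolding B_def by simp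
  have cube: "x \<in> cbox (0 :: real ^ 'n) 1 \<longleftrightarrow> (\<forall>b\<in>B. x \<bullet> b \<in> {0..1})" for x
    by (auto simp: B_def Basis_vec_def mem_unit_cube inner_axis)
  have "emeasure lborel H = emeasure (distr (\<Pi>\<^sub>M b\<in>B. lborel) borel (\<lambda>f. \<Sum>b\<in>B. f b *\<^sub>R b)) H"
    unfolding B_def by (subst lborel_eq) (rule refl)
  also have "\<dots> = emeasure (\<Pi>\<^sub>M b\<in>B. lborel)
      ((\<lambda>f. \<Sum>b\<in>B. f b *\<^sub>R b) -` H \<inter> space (\<Pi>\<^sub>M b\<in>B. lborel))"
    by (intro emeasure_distr meas) (simp add: B_def)
  also have "(\<lambda>f. \<Sum>b\<in>B. f b *\<^sub>R b) -` H \<inter> space (\<Pi>\<^sub>M b\<in>B. lborel)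
     = {f \<in> space (\<Pi>\<^sub>M b\<in>B. lborel). (\<forall>b\<in>B. f b \<in> {0..1}) \<and> t \<le> (\<Prod>b\<in>B. f b)}"
    by (auto simp: H_def cube prod_Basis_cart[symmetric] inner simp flip: B_def cong: prod.cong)
  also have "emeasure (\<Pi>\<^sub>M b\<in>B. lborel) \<dots> = ennreal (t * exp_tail (card B) (- ln t))"
    by (rule emeasure_PiM_prod_ge) (use assms in \<open>auto simp: B_def\<close>)
  finally have em: "emeasure lborel H = ennreal (t * exp_tail CARD('n) (- ln t))"
    by (simp add: B_def)
  then have eml: "emeasure lebesgue H = ennreal (t * exp_tail CARD('n) (- ln t))"
    using meas by simp
  then show "H \<in> lmeasurable"
    using meas by (intro fmeasurableI) auto
  show "measure lebesgue H = t * exp_tail CARD('n) (- ln t)"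
    unfolding measure_def eml using assms by (simp add: exp_tail_nonneg)
qed

section \<open>Volume bounds for sumfree sets\<close>

text \<open>\<open>x\<close> and \<open>z - x\<close> sum to \<open>z\<close>, so they cannot both
  lie in \<open>S\<close>; the reflection preserves volume, so \<open>S\<close> fills at most half
  of the box.\<close>

lemma sumfree_missing_below:
  fixes z :: "real ^ 'n::finite"
  assumes S: "sumfree S" "S \<in> sets lebesgue" and z: "z \<in> S" "z \<in> cbox 0 1"
  shows "measure lebesgue (cbox 0 z - S) \<ge> (\<Prod>i\<in>UNIV. z $ i) / 2"
proof -
  define A where "A = S \<inter> cbox 0 z"
  have A: "A \<in> lmeasurable"
    unfolding A_def using S
    by (intro bounded_set_imp_lmeasurable bounded_Int disjI2 bounded_cbox sets.Int) auto
  have refl: "measure lebesgue ((\<lambda>x. z - x) ` A) = measure lebesgue A"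
    using measure_lebesgue_affine[of "-1" z A] by simp
  have "(\<lambda>x. z - x) ` A \<in> sets lebesgue"
    using A by (intro differentiable_image_in_sets_lebesgue) (auto intro!: derivative_intros)
  moreover have sub: "(\<lambda>x. z - x) ` A \<subseteq> cbox 0 z - S"
  proof clarsimp
    fix x assume x: "x \<in> A"
    then have "x + (z - x) = z" "x \<in> S"
      by (auto simp: A_def)
    with S(1) z(1) have "z - x \<notin> S"
      unfolding sumfree_def by blast
    then show "z - x \<in> cbox 0 z \<and> z - x \<notin> S"
      using x by (auto simp: A_def mem_box_cart)
  qed
  moreover have B: "cbox 0 z - S \<in> lmeasurable"
    using S by (intro fmeasurable_Diff) auto
  ultimately have "measure lebesgue A \<le> measure lebesgue (cbox 0 z - S)"
    using measure_mono_fmeasurable[OF sub, of lebesgue] refl by metis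
  moreover have "measure lebesgue A + measure lebesgue (cbox 0 z - S) = measure lebesgue (cbox 0 z)"
  proof -
    have "A \<union> (cbox 0 z - S) = cbox 0 z" "A \<inter> (cbox 0 z - S) = {}"
      by (auto simp: A_def)
    with measure_Un3[OF A B] show ?thesis
      by simp
  qed
  moreover have "measure lebesgue (cbox 0 z) = (\<Prod>i\<in>UNIV. z $ i)"
  proof -
    have "0 \<in> cbox 0 z"
      using z(2) by (simp add: mem_box_cart)
    then show ?thesis
      using content_cbox_cart[of 0 z] by auto
  qed
  ultimately show ?thesis
    by linarith
qed

text \<open>The contrary assumption acts twice: it bounds \<open>\<pi>\<close> on \<open>S\<close>
  by \<open>\<beta>\<close>, so that a level \<open>t \<le> \<beta>\<close> above all of
  \<open>S\<close> exists, and it is what the final volume count contradicts.\<close>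

lemma measure_sumfree_le:
  fixes S :: "(real ^ 'n::finite) set"
  assumes S: "S \<subseteq> cbox 0 1" "S \<in> sets lebesgue" "sumfree S"
    and k: "CARD('n) = k" "2 \<le> k" and root: "is_alpha_root k \<alpha>"
  shows "measure lebesgue S \<le> \<alpha>"
proof (rule ccontr)
  assume "\<not> ?thesis"
  then have large: "\<alpha> < measure lebesgue S"
    by simp
  define L where "L = ln (1 / (2 - 2 * \<alpha>))"
  define \<beta> where "\<beta> = 2 - 2 * \<alpha>"
  \<comment> \<open>The slack in the volume estimate at \<open>t = \<beta>\<close>; it pays for \<open>z\<close> being only nearly maximal.\<close>
  define \<delta> where "\<delta> = \<beta> * (1 - \<beta>)"
  define \<pi> where "\<pi> x = (\<Prod>i\<in>UNIV. x $ i)" for x :: "real ^ 'n"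
  define Q where "Q = cbox (0 :: real ^ 'n) 1"
  obtain n where n: "k = Suc n" "1 \<le> n"
    using k(2) by (cases k) auto
  have \<alpha>: "1 / 2 < \<alpha>" "\<alpha> < 1"
    using root by (auto simp: is_alpha_root_def)
  note L = root_in_log_coordinate[OF \<alpha>, folded L_def \<beta>_def]
  have L_root: "exp_tail (Suc n) L = (1 - \<beta>) / 2"
    using root L(2) L(3)[of k] by (simp add: n)
  have L_power: "1 / 2 \<le> L ^ n / fact n"
    using L_root L(1,2) n(2) by (intro root_power_ge) simp_all
  have \<beta>: "0 < \<beta>" "\<beta> < 1"
    using \<alpha> by (auto simp: \<beta>_def)
  then have \<delta>: "0 < \<delta>"
    by (simp add: \<delta>_def)
  have Q_meas: "Q \<in> lmeasurable"
    by (simp add: Q_def)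
  have "measure lebesgue Q = 1"
  proof -
    have "0 \<in> Q"
      by (simp add: Q_def mem_unit_cube)
    then show ?thesis
      using content_cbox_cart[of "0 :: real ^ 'n" 1] by (auto simp: Q_def)
  qed
  then have miss: "measure lebesgue (Q - S) < \<beta> / 2"
    using measurable_measure_Diff[OF Q_meas S(2)] S(1) large by (simp add: Q_def \<beta>_def)
  have QS: "Q - S \<in> lmeasurable"
    using Q_meas S by (intro fmeasurable_Diff) auto
  have sub: "cbox 0 z \<subseteq> Q" if "z \<in> S" for z
    using that S(1) unfolding Q_def by (auto simp: mem_box_cart subset_iff intro: order_trans)
  have below: "\<pi> z / 2 \<le> measure lebesgue (cbox 0 z - S)" if "z \<in> S" for z
    unfolding \<pi>_def using sumfree_missing_below[OF S(3,2) that] that S(1) by blast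
  have \<pi>_less: "\<pi> z < \<beta>" if "z \<in> S" for z
  proof -
    have "measure lebesgue (cbox 0 z - S) \<le> measure lebesgue (Q - S)"
      using sub[OF that] S by (intro measure_mono_fmeasurable QS) auto
    with below[OF that] miss show ?thesis
      by simp
  qed
  have "S \<noteq> {}"
    using large \<alpha> by auto
  have bdd: "bdd_above (\<pi> ` S)"
    using \<pi>_less by (intro bdd_aboveI2[of _ _ \<beta>]) (auto intro: less_imp_le)
  have "Sup (\<pi> ` S) - \<delta> < Sup (\<pi> ` S)"
    using \<delta> by simp
  then obtain z where z: "z \<in> S" "Sup (\<pi> ` S) - \<delta> < \<pi> z"
    using \<open>S \<noteq> {}\<close> bdd by (auto simp: less_cSup_iff)
  have \<pi>_z: "\<pi> x < \<pi> z + \<delta>" if "x \<in> S" for x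
    using cSUP_upper[OF that bdd] z(2) by simp
  have "0 \<le> \<pi> z"
    using z(1) S(1) by (auto simp: \<pi>_def subset_iff mem_unit_cube intro!: prod_nonneg)
  \<comment> \<open>The cap \<open>\<beta>\<close> keeps \<open>t\<close> where monotonicity holds.
    Both bounds are strict on \<open>S\<close>, so \<open>\<pi> < t\<close> there, and
    \<open>\<delta>\<close> keeps \<open>t\<close> positive even if
    \<open>\<pi> z = 0\<close>.\<close>
  define t where "t = min \<beta> (\<pi> z + \<delta>)"
  have t: "0 < t" "t \<le> \<beta>" "t \<le> \<pi> z + \<delta>" "t \<le> 1"
    using \<beta> \<delta> \<open>0 \<le> \<pi> z\<close> by (auto simp: t_def)
  have \<pi>_less_t: "\<pi> x < t" if "x \<in> S" for x
    using \<pi>_less[OF that] \<pi>_z[OF that] by (simp add: t_def)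
  define H where "H = {x \<in> Q. t \<le> \<pi> x}"
  note H = hyperbolic_region[where 'n = 'n, OF t(1,4), folded \<pi>_def Q_def, folded H_def]
  have "L \<le> - ln t"
    using t \<beta> by (simp add: L_def \<beta>_def[symmetric] ln_div)
  from exp_tail_weighted_mono[OF less_imp_le[OF L(1)] this L_power]
  have "\<beta> * ((1 - \<beta>) / 2 + 1 / 2) \<le> t * (exp_tail k (- ln t) + 1 / 2)"
    using t L by (simp add: L_root n)
  \<comment> \<open>The left side above equals \<open>\<beta> / 2 + \<delta> / 2\<close>. As
    \<open>t \<le> \<pi> z + \<delta>\<close>, the volume of \<open>H\<close> is at least
    \<open>\<beta> / 2 - \<pi> z / 2\<close>, and the box supplies the remaining
    \<open>\<pi> z / 2\<close>.\<close>
  then have "\<beta> / 2 + \<delta> / 2 - t / 2 \<le> measure lebesgue H"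
    using H(2) k by (simp add: \<delta>_def field_simps)
  moreover have "\<pi> z / 2 \<le> measure lebesgue (cbox 0 z - S)"
    by (rule below[OF z(1)])
  moreover have "measure lebesgue H + measure lebesgue (cbox 0 z - S) \<le> measure lebesgue (Q - S)"
  proof -
    have Z: "cbox 0 z - S \<in> lmeasurable"
      using S by (intro fmeasurable_Diff) auto
    have "\<pi> x \<le> \<pi> z" if "x \<in> cbox 0 z" for x
      using that by (auto simp: \<pi>_def mem_box_cart intro!: prod_mono)
    then have "H \<inter> (cbox 0 z - S) = {}"
      using \<pi>_less_t[OF z(1)] by (force simp: H_def)
    then have "measure lebesgue (H \<union> (cbox 0 z - S)) = measure lebesgue H + measure lebesgue (cbox 0 z - S)"
      by (simp add: measure_Un3[OF H(1) Z])
    moreover have "H \<union> (cbox 0 z - S) \<subseteq> Q - S"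
      using \<pi>_less_t sub[OF z(1)] by (force simp: H_def)
    then have "measure lebesgue (H \<union> (cbox 0 z - S)) \<le> measure lebesgue (Q - S)"
      using H(1) Z by (intro measure_mono_fmeasurable QS) auto
    ultimately show ?thesis
      by simp
  qed
  ultimately show False
    using miss t(3) by simp
qed

theorem theorem5p4:
  fixes k :: nat
  assumes "k \<ge> 2" and "CARD('n::finite) = k"
  shows "(\<exists>!\<alpha>. is_alpha_root k \<alpha>) \<and> (\<forall>\<alpha>. is_alpha_root k \<alpha> \<longrightarrow> c_tilde TYPE('n) \<le> \<alpha>)"
proof (intro conjI allI impI)
  show "\<exists>!\<alpha>. is_alpha_root k \<alpha>"
    by (rule ex1_alpha_root[OF assms(1)])
  fix \<alpha> assume "is_alpha_root k \<alpha>"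
  then show "c_tilde TYPE('n) \<le> \<alpha>"
    unfolding c_tilde_def
    \<comment> \<open>The empty set is sumfree, so the supremum is over a nonempty set, as
      \<open>cSup_least\<close> demands.\<close>
    by (intro cSup_least) (auto simp: sumfree_def intro: measure_sumfree_le[OF _ _ _ assms(2,1)])
qed

end
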